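(* Let $d\ge 3$, $k\ge 2$ be integers and let $\{\Omega_n\}_{n\in\mathbb N}$ be a sequence of finite connected $d$-regular graphs which is an expander, is dg-bounded, and has large girth. Let $\Omega=\bigsqcup_n\Omega_n$. Let $N\ge 1$ and let $Out(F_N)=Aut(F_N)/Inn(F_N)$ be the outer automorphism group of the free group $F_N$ of rank $N$. Then for every integer $j\ge 1$, for almost every $\alpha\in\mathcal A(\Omega,T^j)$, every group homomorphism $\Gamma_\alpha\to Out(F_N)$ has finite image.
   Context: Graphs. For a finite connected graph $\Omega$, $|\Omega|$ is the number of vertices and the Cheeger constant is $h(\Omega)=\min_{1\le |A|\le |\Omega|/2}|\partial A|/|A|$, where $A$ ranges over sets of vertices and $\partial A$ is the set of edges between $A$ and its complement. A sequence $\{\Omega_n\}$ of finite connected graphs of uniformly bounded degree is an expander if $|\Omega_n|\to\infty$ and there is $c>0$ with $h(\Omega_n)\ge c$ for all $n$. The girth of a graph is the edge-length of its shortest non-trivial cycle; the diameter is the greatest edge-length distance between two vertices. The sequence has large girth if $\mathrm{girth}(\Omega_n)\to\infty$, and is dg-bounded if there is $D>0$ with $\mathrm{diam}(\Omega_n)\le D\,\mathrm{girth}(\Omega_n)$ for all $n$. Random monster group. $F_k$ is the free group of rank $k$ with symmetric generating set $T$ of size $2k$ (a free basis and its inverses), and $T^j\subset F_k$ is the set of elements of the form $t_1\cdots t_j$ with $t_i\in T$. A symmetric $F_k$-labelling of a graph is a map $\alpha$ from its oriented edges to $F_k$ with $\alpha(e^{-1})=\alpha(e)^{-1}$ for every edge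 $e$. $\mathcal A(\Omega,T^j)$ is the set of symmetric $F_k$-labellings of $\Omega$ with values in $T^j$; for $\Omega=\bigsqcup_n\Omega_n$ it is given the product of the uniform probability distributions on the finite sets $\mathcal A(\Omega_n,T^j)$, and "almost every" refers to this probability. For $\alpha\in\mathcal A(\Omega,T^j)$, $\Gamma_\alpha$ is the quotient of $F_k$ by the normal closure of all elements $\alpha(e_1)\cdots\alpha(e_m)$, where $e_1\cdots e_m$ is a closed path in $\Omega$. *)

theory Defs
  imports
    "Graph_Theory.Graph_Theory"
    "HOL-Algebra.Bij"
    "HOL-Algebra.Coset"
    "HOL-Probability.Probability"
begin

section \<open>Finite graphs\<close>

text \<open>
  Graphs are finite multigraphs in the sense of Serre: a finite digraph whose arcs are the
  oriented edges, together with a fixed-point-free involution \<open>arev\<close> reversing orientation.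
  Loops and multiple edges are allowed, and simple graphs are the special case without them.
  \<open>bidirected_digraph\<close> also normalises \<open>arev\<close> to be the identity outside the arcs.
  A geometric edge is a pair \<open>{e, arev e}\<close>, so the degree of a vertex is its out-degree.
\<close>

definition finite_connected_graph :: "('a, 'b) pre_digraph \<Rightarrow> ('b \<Rightarrow> 'b) \<Rightarrow> bool" where
  "finite_connected_graph G arev \<longleftrightarrow>
     fin_digraph G \<and> bidirected_digraph G arev \<and> Digraph_Component.connected G"

definition regular_graph :: "nat \<Rightarrow> ('a, 'b) pre_digraph \<Rightarrow> bool" where
  "regular_graph d G \<longleftrightarrow> (\<forall>v\<in>verts G. out_degree G v = d)"

text \<open>Each edge between \<open>A\<close> and its complement is counted once, oriented out of \<open>A\<close>.\<close>

definition edge_boundary :: "('a, 'b) pre_digraph \<Rightarrow> 'a set \<Rightarrow> 'b set" where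
  "edge_boundary G A = {e \<in> arcs G. tail G e \<in> A \<and> head G e \<notin> A}"

text \<open>
  For a finite graph the infimum is a minimum, except for a one-vertex graph, where no \<open>A\<close>
  is admissible and the value is \<open>\<infinity>\<close>.
\<close>

definition cheeger :: "('a, 'b) pre_digraph \<Rightarrow> ereal" where
  "cheeger G =
     (INF A \<in> {A. A \<subseteq> verts G \<and> 1 \<le> card A \<and> real (card A) \<le> real (card (verts G)) / 2}.
        ereal (real (card (edge_boundary G A)) / real (card A)))"

text \<open>
  In a bidirected digraph the closed walk \<open>[e, arev e]\<close> satisfies \<open>pre_digraph.cycle\<close>;
  the second conjunct excludes it, and it is the only additional kind of cycle excluded.
\<close>

definition nontrivial_cycle :: "('a, 'b) pre_digraph \<Rightarrow> ('b \<Rightarrow> 'b) \<Rightarrow> 'b list \<Rightarrow> bool" where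
  "nontrivial_cycle G arev p \<longleftrightarrow> pre_digraph.cycle G p \<and> (\<forall>e\<in>set p. arev e \<notin> set p)"

definition girth :: "('a, 'b) pre_digraph \<Rightarrow> ('b \<Rightarrow> 'b) \<Rightarrow> enat" where
  "girth G arev = (INF p \<in> {p. nontrivial_cycle G arev p}. enat (length p))"

definition graph_diameter :: "('a, 'b) pre_digraph \<Rightarrow> ereal" where
  "graph_diameter G =
     (SUP (u, v) \<in> verts G \<times> verts G. wf_digraph.\<mu> G (\<lambda>_. 1) u v)"

definition expander :: "(nat \<Rightarrow> ('a, 'b) pre_digraph) \<Rightarrow> (nat \<Rightarrow> 'b \<Rightarrow> 'b) \<Rightarrow> bool" where
  "expander \<Omega> arev \<longleftrightarrow>
     (\<forall>n. finite_connected_graph (\<Omega> n) (arev n)) \<and>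
     (\<exists>B. \<forall>n. \<forall>v\<in>verts (\<Omega> n). out_degree (\<Omega> n) v \<le> B) \<and>
     filterlim (\<lambda>n. card (verts (\<Omega> n))) at_top sequentially \<and>
     (\<exists>c::real. c > 0 \<and> (\<forall>n. cheeger (\<Omega> n) \<ge> ereal c))"

text \<open>
  Convergence is in the order topology of \<open>enat\<close>; the filter \<open>at_top\<close> on \<open>enat\<close> would be
  concentrated on the single point \<open>\<infinity>\<close>.
\<close>

definition large_girth :: "(nat \<Rightarrow> ('a, 'b) pre_digraph) \<Rightarrow> (nat \<Rightarrow> 'b \<Rightarrow> 'b) \<Rightarrow> bool" where
  "large_girth \<Omega> arev \<longleftrightarrow> (\<lambda>n. girth (\<Omega> n) (arev n)) \<longlonglongrightarrow> \<infinity>"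

definition dg_bounded :: "(nat \<Rightarrow> ('a, 'b) pre_digraph) \<Rightarrow> (nat \<Rightarrow> 'b \<Rightarrow> 'b) \<Rightarrow> bool" where
  "dg_bounded \<Omega> arev \<longleftrightarrow>
     (\<exists>D::real. D > 0 \<and>
        (\<forall>n. graph_diameter (\<Omega> n) \<le> ereal D * ereal_of_enat (girth (\<Omega> n) (arev n))))"


section \<open>Free groups\<close>

text \<open>
  Elements of the free group on \<open>X\<close> are the reduced words over \<open>X\<close> and its formal inverses.
  A letter \<open>(b, x)\<close> stands for \<open>x\<close> if \<open>b\<close> is true, and for the inverse of \<open>x\<close> otherwise.
\<close>

type_synonym 'x word = "(bool \<times> 'x) list"

fun letter_inv :: "bool \<times> 'x \<Rightarrow> bool \<times> 'x" where
  "letter_inv (b, x) = (\<not> b, x)"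

definition reduced_words :: "'x set \<Rightarrow> 'x word set" where
  "reduced_words X =
     {w. snd ` set w \<subseteq> X \<and> successively (\<lambda>a b. b \<noteq> letter_inv a) w}"

text \<open>Left multiplication of a reduced word by one letter, with free cancellation.\<close>

fun push_letter :: "bool \<times> 'x \<Rightarrow> 'x word \<Rightarrow> 'x word" where
  "push_letter a [] = [a]"
| "push_letter a (b # w) = (if b = letter_inv a then w else a # b # w)"

definition free_group :: "'x set \<Rightarrow> 'x word monoid" where
  "free_group X = \<lparr>carrier = reduced_words X, mult = foldr push_letter, one = []\<rparr>"

lemma letter_inv_letter_inv [simp]: "letter_inv (letter_inv a) = a"
  by (cases a) auto

lemma snd_letter_inv [simp]: "snd (letter_inv a) = snd a"
  by (cases a) auto

lemma letter_inv_neq [simp]: "letter_inv a \<noteq> a" "a \<noteq> letter_inv a"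
  by (cases a; auto)+

lemma reduced_words_set: "w \<in> reduced_words X \<Longrightarrow> snd ` set w \<subseteq> X"
  by (simp add: reduced_words_def)

lemma push_letter_closed:
  "snd a \<in> X \<Longrightarrow> w \<in> reduced_words X \<Longrightarrow> push_letter a w \<in> reduced_words X"
  by (cases w) (auto simp: reduced_words_def successively_Cons)

lemma foldr_push_letter_closed:
  "snd ` set u \<subseteq> X \<Longrightarrow> w \<in> reduced_words X \<Longrightarrow> foldr push_letter u w \<in> reduced_words X"
  by (induction u) (auto intro: push_letter_closed)

lemma push_letter_cancel:
  "w \<in> reduced_words X \<Longrightarrow> push_letter a (push_letter (letter_inv a) w) = w"
  by (cases w; cases "tl w") (auto simp: reduced_words_def successively_Cons)

lemma foldr_push_letter_push_letter:
  assumes "w \<in> reduced_words X" "snd ` set t \<subseteq> X"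
  shows "foldr push_letter (push_letter a t) w = push_letter a (foldr push_letter t w)"
proof (cases t)
  case (Cons b s)
  then show ?thesis
    using assms push_letter_cancel[OF foldr_push_letter_closed[of s X w], of a] by auto
qed auto

lemma set_foldr_push_letter:
  "snd ` set u \<subseteq> X \<Longrightarrow> snd ` set v \<subseteq> X \<Longrightarrow> snd ` set (foldr push_letter u v) \<subseteq> X"
proof (induction u)
  case (Cons a u)
  have "snd ` set (push_letter a w) \<subseteq> X" if "snd ` set w \<subseteq> X" for w
    using that Cons.prems by (cases w) auto
  with Cons show ?case by auto
qed auto

lemma foldr_push_letter_assoc:
  assumes "w \<in> reduced_words X" "snd ` set u \<subseteq> X" "snd ` set v \<subseteq> X"
  shows "foldr push_letter (foldr push_letter u v) w = foldr push_letter u (foldr push_letter v w)"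
  using assms(2)
proof (induction u)
  case (Cons a u)
  then show ?case
    using foldr_push_letter_push_letter[OF assms(1) set_foldr_push_letter[of u X v]] assms(3)
    by auto
qed auto

lemma foldr_push_letter_Nil:
  "successively (\<lambda>a b. b \<noteq> letter_inv a) w \<Longrightarrow> foldr push_letter w [] = w"
proof (induction w)
  case (Cons a w)
  then show ?case by (cases w) (auto simp: successively_Cons)
qed auto

lemma foldr_push_letter_inverse: "foldr push_letter (rev (map letter_inv w)) w = []"
  by (induction w) auto

lemma inverse_word_closed:
  assumes "w \<in> reduced_words X"
  shows "rev (map letter_inv w) \<in> reduced_words X"
proof -
  have "successively (\<lambda>x y. letter_inv x \<noteq> y) w"
    using assms by (auto simp: reduced_words_def elim: successively_mono)
  then show ?thesis
    using assms by (auto simp: reduced_words_def successively_map)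
qed

lemma group_free_group: "group (free_group X)"
proof (rule groupI)
  fix x assume "x \<in> carrier (free_group X)"
  then show "\<exists>y\<in>carrier (free_group X). y \<otimes>\<^bsub>free_group X\<^esub> x = \<one>\<^bsub>free_group X\<^esub>"
    using inverse_word_closed[of x X] foldr_push_letter_inverse[of x]
    by (auto simp: free_group_def)
next
  fix x y assume "x \<in> carrier (free_group X)" "y \<in> carrier (free_group X)"
  then show "x \<otimes>\<^bsub>free_group X\<^esub> y \<in> carrier (free_group X)"
    using foldr_push_letter_closed[of x X y] reduced_words_set[of x X]
    by (simp add: free_group_def)
next
  fix x y z
  assume "x \<in> carrier (free_group X)" "y \<in> carrier (free_group X)" "z \<in> carrier (free_group X)"
  then show "x \<otimes>\<^bsub>free_group X\<^esub> y \<otimes>\<^bsub>free_group X\<^esub> z = x \<otimes>\<^bsub>free_group X\<^esub> (y \<otimes>\<^bsub>free_group X\<^esub> z)"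
    using foldr_push_letter_assoc[of z X x y] reduced_words_set[of x X] reduced_words_set[of y X]
    by (simp add: free_group_def)
qed (simp_all add: free_group_def reduced_words_def)

lemma free_group_simps [simp]:
  "carrier (free_group X) = reduced_words X" "\<one>\<^bsub>free_group X\<^esub> = []"
  by (simp_all add: free_group_def)

lemma inv_free_group:
  "w \<in> reduced_words X \<Longrightarrow> inv\<^bsub>free_group X\<^esub> w = rev (map letter_inv w)"
  by (rule group.inv_equality[OF group_free_group])
     (auto simp: inverse_word_closed foldr_push_letter_inverse, simp add: free_group_def foldr_push_letter_inverse)

abbreviation free_group_rank :: "nat \<Rightarrow> nat word monoid" where
  "free_group_rank k \<equiv> free_group {..<k}"

definition sym_gens :: "nat \<Rightarrow> nat word set" where
  "sym_gens k = {[(b, i)] | b i. i < k}"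

definition group_prod :: "('g, 'm) monoid_scheme \<Rightarrow> 'g list \<Rightarrow> 'g" where
  "group_prod G xs = foldr (\<otimes>\<^bsub>G\<^esub>) xs \<one>\<^bsub>G\<^esub>"

definition sym_gens_pow :: "nat \<Rightarrow> nat \<Rightarrow> nat word set" where
  "sym_gens_pow k j =
     {group_prod (free_group_rank k) ts | ts. length ts = j \<and> set ts \<subseteq> sym_gens k}"


section \<open>The outer automorphism group\<close>

definition Inn :: "('g, 'm) monoid_scheme \<Rightarrow> ('g \<Rightarrow> 'g) set" where
  "Inn G = {(\<lambda>x\<in>carrier G. g \<otimes>\<^bsub>G\<^esub> x \<otimes>\<^bsub>G\<^esub> inv\<^bsub>G\<^esub> g) | g. g \<in> carrier G}"

definition Out :: "('g, 'm) monoid_scheme \<Rightarrow> ('g \<Rightarrow> 'g) set monoid" where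
  "Out G = AutoGroup G Mod Inn G"

lemma (in group) inv_cancel:
  assumes "g \<in> carrier G" "a \<in> carrier G"
  shows "inv g \<otimes> (g \<otimes> a) = a" "g \<otimes> (inv g \<otimes> a) = a"
  using assms by (simp_all flip: m_assoc)

lemma (in group) Inn_normal: "Inn G \<lhd> AutoGroup G"
proof -
  interpret A: group "AutoGroup G" by (rule AutoGroup)
  let ?c = "\<lambda>g. \<lambda>x\<in>carrier G. g \<otimes> x \<otimes> inv g"
  have caut: "?c g \<in> carrier (AutoGroup G)" if g: "g \<in> carrier G" for g
  proof -
    have "bij_betw (?c g) (carrier G) (carrier G)"
      by (rule bij_betw_byWitness[where f' = "?c (inv g)"])
         (use g in \<open>auto simp: m_assoc inv_cancel\<close>)
    moreover have "?c g \<in> hom G G"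
      using g by (auto simp: hom_def m_assoc inv_cancel)
    ultimately show ?thesis using g
      by (auto simp: AutoGroup_def auto_def Bij_def BijGroup_def)
  qed
  have Am: "f \<otimes>\<^bsub>AutoGroup G\<^esub> h = compose (carrier G) f h"
    if "f \<in> carrier (AutoGroup G)" "h \<in> carrier (AutoGroup G)" for f h
    using that by (simp add: AutoGroup_def BijGroup_def auto_def)
  have A1: "\<one>\<^bsub>AutoGroup G\<^esub> = (\<lambda>x\<in>carrier G. x)"
    by (simp add: AutoGroup_def BijGroup_def)
  have cm: "?c g \<otimes>\<^bsub>AutoGroup G\<^esub> ?c h = ?c (g \<otimes> h)" if "g \<in> carrier G" "h \<in> carrier G" for g h
    unfolding Am[OF caut[OF that(1)] caut[OF that(2)]]
    using that by (auto simp: compose_def fun_eq_iff m_assoc inv_mult_group)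
  have c1: "?c \<one> = \<one>\<^bsub>AutoGroup G\<^esub>" by (auto simp: A1 fun_eq_iff)
  have ci: "inv\<^bsub>AutoGroup G\<^esub> ?c g = ?c (inv g)" if "g \<in> carrier G" for g
    by (rule A.inv_equality) (use that cm[of "inv g" g] c1 caut[of g] caut[of "inv g"] in auto)
  have mem: "?c g \<in> Inn G" if "g \<in> carrier G" for g using that unfolding Inn_def by blast
  have sub: "subgroup (Inn G) (AutoGroup G)"
  proof (rule A.subgroupI)
    show "Inn G \<subseteq> carrier (AutoGroup G)" using caut by (auto simp: Inn_def)
    show "Inn G \<noteq> {}" by (auto simp: Inn_def)
  next
    fix a assume "a \<in> Inn G" then show "inv\<^bsub>AutoGroup G\<^esub> a \<in> Inn G"
    proof -
      obtain g where g: "g \<in> carrier G" "a = ?c g" using \<open>a \<in> Inn G\<close> unfolding Inn_def by blast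
      show ?thesis unfolding g(2) ci[OF g(1)] by (rule mem) (use g in simp)
    qed
  next
    fix a b assume "a \<in> Inn G" "b \<in> Inn G" then show "a \<otimes>\<^bsub>AutoGroup G\<^esub> b \<in> Inn G"
    proof -
      obtain g h where g: "g \<in> carrier G" "a = ?c g" and h: "h \<in> carrier G" "b = ?c h"
        using \<open>a \<in> Inn G\<close> \<open>b \<in> Inn G\<close> unfolding Inn_def by blast
      show ?thesis unfolding g(2) h(2) cm[OF g(1) h(1)] by (rule mem) (use g h in simp)
    qed
  qed
  show ?thesis
  proof (rule A.normal_invI[OF sub])
    fix f h assume f: "f \<in> carrier (AutoGroup G)" and h: "h \<in> Inn G"
    from h obtain g where g: "g \<in> carrier G" "h = ?c g" by (auto simp: Inn_def)
    have fh: "f \<in> hom G G" and fb: "f \<in> Bij (carrier G)"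
      using f by (auto simp: AutoGroup_def auto_def)
    interpret f: group_hom G G f by unfold_locales (use fh in auto)
    have fg: "f g \<in> carrier G" using g by simp
    have "f \<otimes>\<^bsub>AutoGroup G\<^esub> h = ?c (f g) \<otimes>\<^bsub>AutoGroup G\<^esub> f"
      unfolding g Am[OF f caut[OF g(1)]] Am[OF caut[OF fg] f]
      using g by (auto simp: compose_def fun_eq_iff)
    then have "f \<otimes>\<^bsub>AutoGroup G\<^esub> h \<otimes>\<^bsub>AutoGroup G\<^esub> inv\<^bsub>AutoGroup G\<^esub> f = ?c (f g)"
      using A.inv_solve_right' f g caut[OF fg] caut[OF g(1)] by auto
    then show "f \<otimes>\<^bsub>AutoGroup G\<^esub> h \<otimes>\<^bsub>AutoGroup G\<^esub> inv\<^bsub>AutoGroup G\<^esub> f \<in> Inn G"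
      using mem[OF fg] by simp
  qed
qed

lemma group_Out: "group G \<Longrightarrow> group (Out G)"
  unfolding Out_def by (intro normal.factorgroup_is_group group.Inn_normal)


section \<open>Random labellings and the random group\<close>

text \<open>
  A labelling of \<open>G\<close> is extensional outside the arcs of \<open>G\<close>, so that these sets are finite.
  A labelling of the disjoint union of the \<open>\<Omega> n\<close> is the sequence of its restrictions.
\<close>

definition labellings :: "('a, 'b) pre_digraph \<Rightarrow> ('b \<Rightarrow> 'b) \<Rightarrow> nat \<Rightarrow> nat \<Rightarrow> ('b \<Rightarrow> nat word) set"
  where
  "labellings G arev k j =
     {\<alpha> \<in> arcs G \<rightarrow>\<^sub>E sym_gens_pow k j.
        \<forall>e\<in>arcs G. \<alpha> (arev e) = inv\<^bsub>free_group_rank k\<^esub> (\<alpha> e)}"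

definition labelling_measure ::
  "(nat \<Rightarrow> ('a, 'b) pre_digraph) \<Rightarrow> (nat \<Rightarrow> 'b \<Rightarrow> 'b) \<Rightarrow> nat \<Rightarrow> nat \<Rightarrow> (nat \<Rightarrow> 'b \<Rightarrow> nat word) measure"
  where
  "labelling_measure \<Omega> arev k j =
     (\<Pi>\<^sub>M n\<in>UNIV. uniform_count_measure (labellings (\<Omega> n) (arev n) k j))"

definition normal_closure :: "('g, 'm) monoid_scheme \<Rightarrow> 'g set \<Rightarrow> 'g set" where
  "normal_closure G R = \<Inter>{H. H \<lhd> G \<and> R \<subseteq> H}"

lemma (in group) normal_closure_normal:
  assumes "R \<subseteq> carrier G"
  shows "normal_closure G R \<lhd> G"
proof (rule normal_invI)
  have c: "carrier G \<lhd> G"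
    by (rule normal_invI[OF subgroup_self]) auto
  show "subgroup (normal_closure G R) G"
    unfolding normal_closure_def using c assms
    by (intro subgroups_Inter) (auto intro: normal_imp_subgroup)
qed (auto simp: normal_closure_def normal.inv_op_closed2)

definition relators ::
  "(nat \<Rightarrow> ('a, 'b) pre_digraph) \<Rightarrow> nat \<Rightarrow> (nat \<Rightarrow> 'b \<Rightarrow> nat word) \<Rightarrow> nat word set" where
  "relators \<Omega> k \<alpha> =
     {group_prod (free_group_rank k) (map (\<alpha> n) p) | n p u. pre_digraph.awalk (\<Omega> n) u p u}"

definition random_group ::
  "(nat \<Rightarrow> ('a, 'b) pre_digraph) \<Rightarrow> nat \<Rightarrow> (nat \<Rightarrow> 'b \<Rightarrow> nat word) \<Rightarrow> nat word set monoid" where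
  "random_group \<Omega> k \<alpha> =
     free_group_rank k Mod normal_closure (free_group_rank k) (relators \<Omega> k \<alpha>)"

end

theory Submission
  imports Defs
begin

text \<open>
  The only property of \<open>Out(F\<^sub>N)\<close> that matters is that it is countable. A homomorphism from the
  random group to a group \<open>H\<close> is a homomorphism \<open>g\<close> from \<open>F\<^sub>k\<close> to \<open>H\<close> that kills all relators, and if
  \<open>H\<close> is countable then there are only countably many \<open>g\<close>, because \<open>F\<^sub>k\<close> is finitely generated
  (\<open>countable_hom_free_group\<close>). So it is enough to show, for each single \<open>g\<close> with infinite image,
  that almost surely some relator is not killed by \<open>g\<close> (\<open>AE_relator_not_killed\<close>); the exceptional
  null sets of the countably many \<open>g\<close> have a null union.

  Write \<open>S\<close> for the set of labels \<open>T\<^sup>j\<close>, and fix \<open>g\<close> with infinite image. Then \<open>g\<close> is not constant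
  on \<open>S\<close>, since otherwise it would be constant on \<open>T = T\<inverse>\<close>, with an image of order at most 2
  (\<open>finite_image_of_constant_on_sym_gens_pow\<close>). Every nonempty finite graph of minimum degree at least 2
  has a closed walk that starts with an edge traversed only once, in either direction
  (\<open>exists_closed_walk_unrepeated_edge\<close>). If \<open>g\<close> kills the label of that walk, then changing the label
  of this edge to one with a different image under \<open>g\<close> gives a labelling for which it does not. Hence
  there are at most \<open>card S\<close> times as many labellings all of whose relators are killed by \<open>g\<close> as
  there are other labellings (\<open>card_flat_labellings_le\<close>), and \<open>g\<close> kills all relators from \<open>\<Omega>\<^sub>n\<close> with probability at most
  \<open>card S / (card S + 1)\<close>, whatever \<open>n\<close> is. The labellings of the different \<open>\<Omega>\<^sub>n\<close> are independent, so
  almost surely \<open>g\<close> fails to kill the relators of some \<open>\<Omega>\<^sub>n\<close>.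
\<close>

section \<open>Homomorphisms out of free groups\<close>

lemma reduced_words_ConsD:
  assumes "a # w \<in> reduced_words X"
  shows "[a] \<in> reduced_words X" "w \<in> reduced_words X" "a # w = [a] \<otimes>\<^bsub>free_group X\<^esub> w"
  using assms by (cases w; auto simp: reduced_words_def free_group_def)+

lemma hom_free_group_Cons:
  assumes "g \<in> hom (free_group X) H" "a # w \<in> reduced_words X"
  shows "g (a # w) = g [a] \<otimes>\<^bsub>H\<^esub> g w"
  using hom_mult[OF assms(1)] reduced_words_ConsD[OF assms(2)] by simp

lemma singleton_reduced_word: "x \<in> X \<Longrightarrow> [(b, x)] \<in> reduced_words X"
  by (simp add: reduced_words_def)

lemma countable_hom_free_group:
  assumes "finite X" "group H" "countable (carrier H)"
  shows "countable {g \<in> hom (free_group X) H. g \<in> extensional (reduced_words X)}" (is "countable ?C")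
proof (rule countable_image_inj_on)
  let ?r = "\<lambda>g. \<lambda>a \<in> UNIV \<times> X. g [a]"
  have "?r ` ?C \<subseteq> UNIV \<times> X \<rightarrow>\<^sub>E carrier H"
    by (auto simp: singleton_reduced_word hom_in_carrier[of _ "free_group X"] split: if_splits)
  moreover have "countable ((UNIV :: bool set) \<times> X \<rightarrow>\<^sub>E carrier H)"
    using assms by (intro countable_PiE) auto
  ultimately show "countable (?r ` ?C)"
    by (rule countable_subset)
  show "inj_on ?r ?C"
  proof (rule inj_onI)
    fix g h assume g: "g \<in> ?C" and h: "h \<in> ?C" and eq: "?r g = ?r h"
    have letter: "g [a] = h [a]" if "snd a \<in> X" for a
      using fun_cong[OF eq, of a] that by (cases a) auto
    have "g w = h w" if "w \<in> reduced_words X" for w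
      using that
    proof (induction w)
      case Nil
      then show ?case
        using g h hom_one[OF _ group_free_group assms(2), of g X]
          hom_one[OF _ group_free_group assms(2), of h X] by simp
    next
      case (Cons a w)
      have "snd a \<in> X" using Cons.prems by (simp add: reduced_words_def)
      then show ?case
        using g h Cons.IH reduced_words_ConsD(2)[OF Cons.prems] letter[of a]
        by (simp add: hom_free_group_Cons[OF _ Cons.prems, of _ H])
    qed
    then show "g = h"
      using g h by (auto intro: extensionalityI)
  qed
qed

lemma countable_reduced_words: "countable (reduced_words (X :: nat set))"
  by (rule countable_subset[OF subset_UNIV]) simp

text \<open>
  An automorphism is in particular an extensional homomorphism from the free group to itself.
\<close>

lemma countable_Out_free_group: "countable (carrier (Out (free_group_rank N)))"
proof -
  have "carrier (AutoGroup (free_group_rank N)) \<subseteq>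
      {g \<in> hom (free_group_rank N) (free_group_rank N). g \<in> extensional (reduced_words {..<N})}"
    by (auto simp: AutoGroup_def auto_def Bij_def)
  then have "countable (carrier (AutoGroup (free_group_rank N)))"
    by (rule countable_subset)
       (auto intro!: countable_hom_free_group group_free_group countable_reduced_words)
  then show ?thesis
    by (simp add: Out_def carrier_FactGroup)
qed


section \<open>The set of labels\<close>

lemma (in group) group_prod_closed: "set xs \<subseteq> carrier G \<Longrightarrow> group_prod G xs \<in> carrier G"
  by (induction xs) (auto simp: group_prod_def)

lemma (in group) group_prod_append:
  "set xs \<subseteq> carrier G \<Longrightarrow> set ys \<subseteq> carrier G \<Longrightarrow>
     group_prod G (xs @ ys) = group_prod G xs \<otimes> group_prod G ys"
  using group_prod_closed[of ys]
  by (induction xs) (auto simp: group_prod_def m_assoc group_prod_closed[unfolded group_prod_def])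

lemma (in group) inv_group_prod:
  "set xs \<subseteq> carrier G \<Longrightarrow> inv (group_prod G xs) = group_prod G (rev (map (m_inv G) xs))"
proof (induction xs)
  case (Cons x xs)
  have "set (rev (map (m_inv G) xs)) \<subseteq> carrier G" using Cons.prems by auto
  then show ?case
    using Cons group_prod_closed[of xs]
    by (simp add: group_prod_append inv_mult_group) (simp add: group_prod_def inv_mult_group)
qed (simp add: group_prod_def)

lemma sym_gens_carrier: "sym_gens k \<subseteq> reduced_words {..<k}"
  by (auto simp: sym_gens_def singleton_reduced_word)

lemma sym_gens_inv: "t \<in> sym_gens k \<Longrightarrow> inv\<^bsub>free_group_rank k\<^esub> t \<in> sym_gens k"
  by (auto simp: sym_gens_def inv_free_group singleton_reduced_word)

lemma finite_sym_gens: "finite (sym_gens k)"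
proof -
  have "sym_gens k = (\<lambda>a. [a]) ` (UNIV \<times> {..<k})" by (auto simp: sym_gens_def)
  then show ?thesis by simp
qed

lemma sym_gens_pow_carrier: "sym_gens_pow k j \<subseteq> reduced_words {..<k}"
proof -
  interpret F: group "free_group_rank k" by (rule group_free_group)
  show ?thesis
    using F.group_prod_closed sym_gens_carrier[of k] by (fastforce simp: sym_gens_pow_def)
qed

lemma finite_sym_gens_pow: "finite (sym_gens_pow k j)"
proof -
  have "sym_gens_pow k j =
      group_prod (free_group_rank k) ` {ts. set ts \<subseteq> sym_gens k \<and> length ts = j}"
    by (auto simp: sym_gens_pow_def)
  then show ?thesis
    using finite_lists_length_eq[OF finite_sym_gens] by simp
qed

lemma sym_gens_pow_inv:
  assumes "s \<in> sym_gens_pow k j"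
  shows "inv\<^bsub>free_group_rank k\<^esub> s \<in> sym_gens_pow k j"
proof -
  interpret F: group "free_group_rank k" by (rule group_free_group)
  obtain ts where ts: "s = group_prod (free_group_rank k) ts" "length ts = j" "set ts \<subseteq> sym_gens k"
    using assms by (auto simp: sym_gens_pow_def)
  have "inv\<^bsub>free_group_rank k\<^esub> s =
      group_prod (free_group_rank k) (rev (map (m_inv (free_group_rank k)) ts))"
    using F.inv_group_prod[of ts] ts sym_gens_carrier[of k] by auto
  then show ?thesis
    using ts(2,3) sym_gens_inv[of _ k] unfolding sym_gens_pow_def
    by (intro CollectI exI[of _ "rev (map (m_inv (free_group_rank k)) ts)"]) auto
qed

text \<open>
  Multiplying all generators by one fixed product of \<open>j - 1\<close> generators shows that \<open>g\<close> is constant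
  on the generators themselves.
\<close>

lemma finite_image_of_constant_on_sym_gens_pow:
  assumes g: "g \<in> hom (free_group_rank k) H" and H: "group H" and "j \<ge> 1"
    and const: "\<And>s. s \<in> sym_gens_pow k j \<Longrightarrow> g s = q"
  shows "finite (g ` reduced_words {..<k})"
proof -
  let ?F = "free_group_rank k"
  interpret F: group ?F by (rule group_free_group)
  interpret H: group H by (rule H)
  interpret g: group_hom ?F H g by unfold_locales (rule g)
  have eq: "g t = g s" if t: "t \<in> sym_gens k" and s: "s \<in> sym_gens k" for s t
  proof -
    let ?w = "replicate (j - 1) t"
    have w: "set ?w \<subseteq> sym_gens k" using t by auto
    then have wc: "group_prod ?F ?w \<in> carrier ?F"
      using F.group_prod_closed[of ?w] sym_gens_carrier[of k] by auto
    have pow: "u \<otimes>\<^bsub>?F\<^esub> group_prod ?F ?w \<in> sym_gens_pow k j" if "u \<in> sym_gens k" for u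
      unfolding sym_gens_pow_def using that w \<open>j \<ge> 1\<close>
      by (intro CollectI exI[of _ "u # ?w"]) (auto simp: group_prod_def)
    have carr: "t \<in> carrier ?F" "s \<in> carrier ?F" using s t sym_gens_carrier[of k] by auto
    have "g t \<otimes>\<^bsub>H\<^esub> g (group_prod ?F ?w) = g s \<otimes>\<^bsub>H\<^esub> g (group_prod ?F ?w)"
      using const[OF pow[OF t]] const[OF pow[OF s]] hom_mult[OF g _ wc] carr by simp
    then show ?thesis
      using H.right_cancel[of "g (group_prod ?F ?w)" "g t" "g s"]
        hom_in_carrier[OF g wc] hom_in_carrier[OF g carr(1)] hom_in_carrier[OF g carr(2)] by simp
  qed
  show ?thesis
  proof (cases "sym_gens k = {}")
    case True
    then have "k = 0" by (auto simp: sym_gens_def)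
    then have "reduced_words {..<k} \<subseteq> {[]}" by (auto simp: reduced_words_def)
    then show ?thesis using finite_subset by blast
  next
    case False
    then obtain t where t: "t \<in> sym_gens k" by auto
    then have tc: "t \<in> carrier ?F" using sym_gens_carrier by auto
    define x where "x = g t"
    have x: "x \<in> carrier H" using tc hom_in_carrier[OF g] by (simp add: x_def)
    \<comment> \<open>The inverse of a generator is a generator, so the common value is an involution.\<close>
    have "inv\<^bsub>H\<^esub> x = x"
      using g.hom_inv[OF tc] eq[OF sym_gens_inv[OF t] t] by (simp add: x_def)
    then have xx: "x \<otimes>\<^bsub>H\<^esub> x = \<one>\<^bsub>H\<^esub>" using H.r_inv[OF x] by simp
    have "g w \<in> {\<one>\<^bsub>H\<^esub>, x}" if "w \<in> reduced_words {..<k}" for w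
      using that
    proof (induction w)
      case Nil
      then show ?case using g.hom_one by simp
    next
      case (Cons a w)
      have "[a] \<in> sym_gens k"
        using Cons.prems by (cases a) (auto simp: sym_gens_def reduced_words_def)
      then have "g [a] = x" unfolding x_def by (rule eq[OF _ t])
      then show ?case
        using Cons.IH reduced_words_ConsD(2)[OF Cons.prems] x xx
        by (auto simp: hom_free_group_Cons[OF g Cons.prems])
    qed
    then have "g ` reduced_words {..<k} \<subseteq> {\<one>\<^bsub>H\<^esub>, x}" by blast
    then show ?thesis using finite_subset by blast
  qed
qed


section \<open>A closed walk with an unrepeated edge\<close>

text \<open>
  Follow an infinite walk that never backtracks up to the first vertex that it visits for the second
  time, and keep the part between the two visits. Its vertices are distinct, so its first edge
  is not repeated, and the reverse of the first edge could only occur as the second edge, which is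
  backtracking.
\<close>

lemma (in bidirected_digraph) exists_closed_walk_unrepeated_edge:
  assumes fin: "finite (verts G)" and ne: "verts G \<noteq> {}"
    and deg: "\<And>v. v \<in> verts G \<Longrightarrow> out_degree G v \<ge> 2"
  shows "\<exists>e p. awalk (tail G e) (e # p) (tail G e) \<and> e \<notin> set p \<and> arev e \<notin> set p"
proof -
  have next_arc: "\<exists>e. e \<in> arcs G \<and> tail G e = v \<and> e \<noteq> a" if "v \<in> verts G" for v a
  proof (rule ccontr)
    assume "\<not> ?thesis"
    then have "out_arcs G v \<subseteq> {a}" by (auto simp: out_arcs_def)
    then have "card (out_arcs G v) \<le> card {a}" by (intro card_mono) auto
    then show False using deg[OF that] by (simp add: out_degree_def)
  qed
  have "\<exists>f. \<forall>n. f n \<in> arcs G \<and> (tail G (f (Suc n)) = head G (f n) \<and> f (Suc n) \<noteq> arev (f n))"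
  proof (rule dependent_nat_choice)
    show "\<exists>x. x \<in> arcs G" using ne next_arc by blast
    show "\<exists>y. y \<in> arcs G \<and> tail G y = head G x \<and> y \<noteq> arev x" if "x \<in> arcs G" for x
      using next_arc[of "head G x" "arev x"] that by auto
  qed
  then obtain f where arc: "\<And>n. f n \<in> arcs G"
    and tail: "\<And>n. tail G (f (Suc n)) = head G (f n)"
    and nonbacktracking: "\<And>n. f (Suc n) \<noteq> arev (f n)" by blast
  let ?v = "\<lambda>n. tail G (f n)"
  let ?rep = "\<lambda>n. \<exists>i<n. ?v i = ?v n"
  have "range ?v \<subseteq> verts G" using arc by auto
  then have "\<not> inj ?v"
    using fin finite_subset finite_imageD infinite_UNIV_nat by blast
  then obtain a b where "a \<noteq> b" "?v a = ?v b" by (auto simp: inj_on_def)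
  then have "\<exists>n. ?rep n" by (metis linorder_neqE_nat)
  then have rep: "?rep (LEAST n. ?rep n)" by (rule LeastI_ex)
  define m where "m = (LEAST n. ?rep n)"
  obtain i where i: "i < m" "?v i = ?v m" using rep by (auto simp: m_def)
  \<comment> \<open>By minimality of \<open>m\<close>, no vertex is repeated before time \<open>m\<close>.\<close>
  have distinct: "a = b" if "a < m" "b < m" "?v a = ?v b" for a b
    using not_less_Least[of a ?rep] not_less_Least[of b ?rep] that unfolding m_def
    by (metis linorder_neqE_nat)
  have walk: "awalk (?v a) (map f [a..<b]) (?v b)" if "a \<le> b" for a b
    using that
  proof (induction rule: inc_induct)
    case base
    then show ?case using arc by (simp add: awalk_Nil_iff)
  next
    case (step n)
    then show ?case using arc by (simp add: upt_conv_Cons awalk_Cons_iff tail)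
  qed
  let ?p = "map f [Suc i..<m]"
  have "awalk (?v i) (f i # ?p) (?v i)"
    using walk[of i m] i by (simp add: upt_conv_Cons)
  moreover have "f i \<notin> set ?p"
  proof
    assume "f i \<in> set ?p"
    then obtain n where "Suc i \<le> n" "n < m" "f i = f n" by auto
    then show False using distinct[of i n] i by simp
  qed
  moreover have "arev (f i) \<notin> set ?p"
  proof
    assume "arev (f i) \<in> set ?p"
    then obtain n where n: "Suc i \<le> n" "n < m" "arev (f i) = f n" by auto
    then have "?v n = ?v (Suc i)" using arc tail by (metis tail_arev)
    then have "n = Suc i" using distinct[of n "Suc i"] n by simp
    then show False using n(3) nonbacktracking[of i] by simp
  qed
  ultimately show ?thesis by blast
qed


section \<open>Resampling one label\<close>

text \<open>
  The labelling \<open>\<alpha>\<close> is flat over \<open>g\<close> if \<open>g\<close> kills the product of the labels along every closed walk.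
\<close>

definition flat_labelling ::
  "('a, 'b) pre_digraph \<Rightarrow> nat \<Rightarrow> ('h, 'm) monoid_scheme \<Rightarrow> (nat word \<Rightarrow> 'h) \<Rightarrow> ('b \<Rightarrow> nat word) \<Rightarrow> bool"
  where
  "flat_labelling G k H g \<alpha> \<longleftrightarrow>
     (\<forall>u p. pre_digraph.awalk G u p u \<longrightarrow> g (group_prod (free_group_rank k) (map \<alpha> p)) = \<one>\<^bsub>H\<^esub>)"

text \<open>
  \<open>relabel arev k e s \<alpha>\<close> gives the edge \<open>e\<close> the label \<open>s\<close>, and the reversed edge the inverse label,
  so that the labelling stays symmetric.
\<close>

definition relabel :: "('b \<Rightarrow> 'b) \<Rightarrow> nat \<Rightarrow> 'b \<Rightarrow> nat word \<Rightarrow> ('b \<Rightarrow> nat word) \<Rightarrow> 'b \<Rightarrow> nat word" where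
  "relabel arev k e s \<alpha> = \<alpha>(e := s, arev e := inv\<^bsub>free_group_rank k\<^esub> s)"

lemma finite_labellings: "finite (arcs G) \<Longrightarrow> finite (labellings G arev k j)"
  using finite_PiE[of "arcs G" "\<lambda>_. sym_gens_pow k j"] finite_sym_gens_pow[of k j]
  by (auto simp: labellings_def)

context bidirected_digraph
begin

lemma relabel_in_labellings:
  assumes "\<alpha> \<in> labellings G arev k j" "e \<in> arcs G" "s \<in> sym_gens_pow k j"
  shows "relabel arev k e s \<alpha> \<in> labellings G arev k j"
proof -
  interpret F: group "free_group_rank k" by (rule group_free_group)
  have "s \<in> reduced_words {..<k}" using assms(3) sym_gens_pow_carrier by blast
  then have "inv\<^bsub>free_group_rank k\<^esub> (inv\<^bsub>free_group_rank k\<^esub> s) = s" by (intro F.inv_inv) simp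
  moreover have "arev e \<in> arcs G" "arev e \<noteq> e"
    using assms(2) arev_dom arev_arev by metis+
  moreover have "arev x = e \<longleftrightarrow> x = arev e" "arev x = arev e \<longleftrightarrow> x = e" for x
    by (metis arev_arev)+
  ultimately show ?thesis
    using assms sym_gens_pow_inv[OF assms(3)]
    by (auto simp: labellings_def relabel_def PiE_iff extensional_def)
qed

lemma relabel_relabel:
  assumes "\<alpha> \<in> labellings G arev k j" "e \<in> arcs G"
  shows "relabel arev k e (\<alpha> e) (relabel arev k e s \<alpha>) = \<alpha>"
  using assms by (auto simp: labellings_def relabel_def fun_eq_iff)

text \<open>
  Replacing the label of the unrepeated edge by one with a different image under \<open>g\<close> destroys
  flatness, and the old label together with the new labelling determines the old labelling.
\<close>

lemma card_flat_labellings_le: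
  assumes walk: "awalk (tail G e) (e # p) (tail G e)" and e: "e \<notin> set p" "arev e \<notin> set p"
    and fin: "finite (arcs G)"
    and g: "g \<in> hom (free_group_rank k) H" and H: "group H"
    and nonconst: "\<And>q. \<exists>s\<in>sym_gens_pow k j. g s \<noteq> q"
  shows "card {\<alpha> \<in> labellings G arev k j. flat_labelling G k H g \<alpha>}
       \<le> card (sym_gens_pow k j) * card {\<alpha> \<in> labellings G arev k j. \<not> flat_labelling G k H g \<alpha>}"
    (is "card ?A \<le> card ?S * card ?B")
proof -
  let ?F = "free_group_rank k"
  interpret F: group ?F by (rule group_free_group)
  interpret H: group H by (rule H)
  have arcs: "e \<in> arcs G" "set p \<subseteq> arcs G" using walk by (auto simp: awalk_def)
  obtain s where s: "\<And>q. s q \<in> ?S" "\<And>q. g (s q) \<noteq> q" using nonconst by metis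
  let ?f = "\<lambda>\<alpha>. relabel arev k e (s (g (\<alpha> e))) \<alpha>"
  have lab: "\<alpha> x \<in> ?S" if "\<alpha> \<in> labellings G arev k j" "x \<in> arcs G" for \<alpha> x
    using that by (auto simp: labellings_def)
  have nonflat: "\<not> flat_labelling G k H g (?f \<alpha>)" if \<alpha>: "\<alpha> \<in> ?A" for \<alpha>
  proof
    assume flat: "flat_labelling G k H g (?f \<alpha>)"
    let ?c = "group_prod ?F (map \<alpha> p)" and ?s = "s (g (\<alpha> e))"
    have "set (map \<alpha> p) \<subseteq> carrier ?F"
      using \<alpha> lab[of \<alpha>] arcs sym_gens_pow_carrier[of k j] by fastforce
    then have c: "?c \<in> carrier ?F" by (rule F.group_prod_closed)
    have carr: "\<alpha> e \<in> carrier ?F" "?s \<in> carrier ?F"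
      using \<alpha> lab[of \<alpha> e] arcs s(1) sym_gens_pow_carrier[of k j] by auto
    have "map (?f \<alpha>) p = map \<alpha> p" using e by (auto simp: relabel_def)
    moreover have "?f \<alpha> e = ?s" using arev_dom[of e] arcs(1) by (auto simp: relabel_def)
    ultimately have "group_prod ?F (map (?f \<alpha>) (e # p)) = ?s \<otimes>\<^bsub>?F\<^esub> ?c"
      by (simp add: group_prod_def del: map_eq_conv)
    then have "g (?s \<otimes>\<^bsub>?F\<^esub> ?c) = \<one>\<^bsub>H\<^esub>"
      using flat walk unfolding flat_labelling_def by metis
    moreover have "flat_labelling G k H g \<alpha>" using \<alpha> by simp
    then have "g (group_prod ?F (map \<alpha> (e # p))) = \<one>\<^bsub>H\<^esub>"
      using walk unfolding flat_labelling_def by blast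
    then have "g (\<alpha> e \<otimes>\<^bsub>?F\<^esub> ?c) = \<one>\<^bsub>H\<^esub>"
      by (simp add: group_prod_def)
    ultimately have "g ?s \<otimes>\<^bsub>H\<^esub> g ?c = g (\<alpha> e) \<otimes>\<^bsub>H\<^esub> g ?c"
      using hom_mult[OF g _ c] carr by simp
    then have "g ?s = g (\<alpha> e)"
      using H.right_cancel[of "g ?c" "g ?s" "g (\<alpha> e)"]
        hom_in_carrier[OF g c] hom_in_carrier[OF g carr(1)] hom_in_carrier[OF g carr(2)] by simp
    then show False using s(2) by blast
  qed
  have "card ?A \<le> card (?S \<times> ?B)"
  proof (rule card_inj_on_le[where f = "\<lambda>\<alpha>. (\<alpha> e, ?f \<alpha>)"])
    show "inj_on (\<lambda>\<alpha>. (\<alpha> e, ?f \<alpha>)) ?A"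
    proof (rule inj_onI)
      fix \<alpha> \<beta> assume lab: "\<alpha> \<in> ?A" "\<beta> \<in> ?A" and eq: "(\<alpha> e, ?f \<alpha>) = (\<beta> e, ?f \<beta>)"
      have "\<alpha> = relabel arev k e (\<alpha> e) (?f \<alpha>)"
        using lab relabel_relabel[OF _ arcs(1), where j = j] by simp
      also have "\<dots> = relabel arev k e (\<beta> e) (?f \<beta>)"
        by (rule arg_cong2[where f = "relabel arev k e"]) (use eq in blast)+
      also have "\<dots> = \<beta>"
        using lab relabel_relabel[OF _ arcs(1), where j = j] by simp
      finally show "\<alpha> = \<beta>" .
    qed
    show "(\<lambda>\<alpha>. (\<alpha> e, ?f \<alpha>)) ` ?A \<subseteq> ?S \<times> ?B"
    proof (rule image_subsetI)
      fix \<alpha> assume "\<alpha> \<in> ?A"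
      then show "(\<alpha> e, ?f \<alpha>) \<in> ?S \<times> ?B"
        using lab[of \<alpha> e] arcs(1) nonflat[of \<alpha>] relabel_in_labellings[OF _ arcs(1) s(1)] by simp
    qed
    show "finite (?S \<times> ?B)"
      using finite_sym_gens_pow finite_labellings[OF fin] by auto
  qed
  then show ?thesis by (simp add: card_cartesian_product)
qed

end

lemma measure_flat_labellings_le:
  assumes G: "finite_connected_graph G arev" and deg: "\<And>v. v \<in> verts G \<Longrightarrow> out_degree G v \<ge> 2"
    and g: "g \<in> hom (free_group_rank k) H" and H: "group H"
    and nonconst: "\<And>q. \<exists>s\<in>sym_gens_pow k j. g s \<noteq> q"
    and ne: "labellings G arev k j \<noteq> {}"
  shows "measure (uniform_count_measure (labellings G arev k j))
           {\<alpha> \<in> labellings G arev k j. flat_labelling G k H g \<alpha>}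
       \<le> real (card (sym_gens_pow k j)) / (real (card (sym_gens_pow k j)) + 1)"
proof -
  let ?L = "labellings G arev k j" and ?S = "sym_gens_pow k j"
  let ?A = "{\<alpha> \<in> ?L. flat_labelling G k H g \<alpha>}" and ?B = "{\<alpha> \<in> ?L. \<not> flat_labelling G k H g \<alpha>}"
  interpret fin_digraph G using G by (simp add: finite_connected_graph_def)
  interpret bidirected_digraph G arev using G by (simp add: finite_connected_graph_def)
  have "verts G \<noteq> {}"
    using G by (auto simp: finite_connected_graph_def connected_def strongly_connected_def)
  then obtain e p where walk: "awalk (tail G e) (e # p) (tail G e)" "e \<notin> set p" "arev e \<notin> set p"
    using exists_closed_walk_unrepeated_edge deg by auto
  have le: "card ?A \<le> card ?S * card ?B"
    using card_flat_labellings_le[OF walk _ g H nonconst] by simp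
  have fin: "finite ?L" by (rule finite_labellings) simp
  have "card ?L = card ?A + card ?B"
    using fin by (subst card_Un_disjoint[symmetric]) (auto intro!: arg_cong[where f = card])
  then have L: "real (card ?L) = real (card ?A) + real (card ?B)" by simp
  have "real (card ?A) \<le> real (card ?S) * real (card ?B)"
    using of_nat_mono[OF le, where 'a = real] by simp
  then have "real (card ?A) * (real (card ?S) + 1) \<le> real (card ?S) * real (card ?L)"
    unfolding L by (simp add: algebra_simps)
  moreover have "card ?L > 0" using ne fin by (simp add: card_gt_0_iff)
  ultimately have "real (card ?A) / real (card ?L) \<le> real (card ?S) / (real (card ?S) + 1)"
    by (simp add: divide_simps)
  then show ?thesis
    using fin by (simp add: measure_uniform_count_measure)
qed


section \<open>Independence\<close>

text \<open>
  Independent events whose probabilities are bounded away from 1 almost surely do not all occur.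
\<close>

lemma AE_PiM_exists_notin:
  fixes M :: "nat \<Rightarrow> 'a measure"
  assumes M: "\<And>n. prob_space (M n)" and A: "\<And>n. A n \<in> sets (M n)"
    and le: "\<And>n. measure (M n) (A n) \<le> c" and c: "c < 1"
  shows "AE x in PiM UNIV M. \<exists>n. x n \<notin> A n"
proof -
  interpret product_prob_space M UNIV
    by (intro product_prob_spaceI M)
  let ?P = "PiM UNIV M"
  let ?N = "{x \<in> space ?P. \<forall>n. x n \<in> A n}"
  have c0: "0 \<le> c" using measure_nonneg[of "M 0" "A 0"] le[of 0] by linarith
  have N: "?N \<in> sets ?P"
    using A by (intro sets.sets_Collect_countable_All sets_Collect_single') (auto simp: sets.Int_space_eq2)
  have bound: "P.prob ?N \<le> c ^ m" for m
  proof -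
    have "P.prob ?N \<le> P.prob (prod_emb UNIV M {..<m} (Pi\<^sub>E {..<m} A))"
      using A by (intro P.finite_measure_mono sets_PiM_I) (auto simp: prod_emb_def space_PiM)
    also have "\<dots> = (\<Prod>n<m. measure (M n) (A n))"
      using A by (intro measure_PiM_emb) auto
    also have "\<dots> \<le> (\<Prod>n<m. c)"
      using le by (intro prod_mono) auto
    finally show ?thesis by simp
  qed
  have "(\<lambda>m. c ^ m) \<longlonglongrightarrow> 0" using c0 c by (intro LIMSEQ_realpow_zero)
  then have "P.prob ?N \<le> 0"
    using bound by (intro tendsto_le[OF sequentially_bot _ tendsto_const]) auto
  then have "P.prob ?N = 0" using measure_nonneg[of ?P ?N] by linarith
  then have "emeasure ?P ?N = 0" by (simp add: P.emeasure_eq_measure)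
  then show ?thesis
    using N by (intro AE_I'[of ?N]) (auto simp: null_sets_def)
qed

text \<open>
  A homomorphism from the free group with infinite image almost surely does not factor through
  the random group.
\<close>

lemma AE_relator_not_killed:
  assumes G: "\<And>n. finite_connected_graph (\<Omega> n) (arev n)"
    and deg: "\<And>n v. v \<in> verts (\<Omega> n) \<Longrightarrow> out_degree (\<Omega> n) v \<ge> 2"
    and "j \<ge> 1" and g: "g \<in> hom (free_group_rank k) H" and H: "group H"
    and inf: "infinite (g ` reduced_words {..<k})"
  shows "AE \<alpha> in labelling_measure \<Omega> arev k j. \<exists>r\<in>relators \<Omega> k \<alpha>. g r \<noteq> \<one>\<^bsub>H\<^esub>"
proof (cases "\<forall>n. labellings (\<Omega> n) (arev n) k j \<noteq> {}")
  case True
  let ?L = "\<lambda>n. labellings (\<Omega> n) (arev n) k j"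
  let ?A = "\<lambda>n. {\<alpha> \<in> ?L n. flat_labelling (\<Omega> n) k H g \<alpha>}"
  let ?c = "real (card (sym_gens_pow k j)) / (real (card (sym_gens_pow k j)) + 1)"
  have nonconst: "\<exists>s\<in>sym_gens_pow k j. g s \<noteq> q" for q
    using finite_image_of_constant_on_sym_gens_pow[OF g H \<open>j \<ge> 1\<close>, of q] inf by blast
  have "finite (?L n)" for n
    using G[of n] by (intro finite_labellings)
      (auto simp: finite_connected_graph_def dest: fin_digraph.finite_arcs)
  then have "AE \<alpha> in PiM UNIV (\<lambda>n. uniform_count_measure (?L n)). \<exists>n. \<alpha> n \<notin> ?A n"
    using True
    by (intro AE_PiM_exists_notin[where c = ?c] prob_space_uniform_count_measure
          measure_flat_labellings_le G deg g H nonconst)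
       (auto simp: sets_uniform_count_measure divide_simps)
  then show ?thesis
    unfolding labelling_measure_def
  proof (rule AE_mp, intro AE_I2 impI)
    fix \<alpha> assume \<alpha>: "\<alpha> \<in> space (PiM UNIV (\<lambda>n. uniform_count_measure (?L n)))"
      and "\<exists>n. \<alpha> n \<notin> ?A n"
    then obtain n where n: "\<alpha> n \<notin> ?A n" by blast
    moreover have "\<alpha> n \<in> ?L n"
      using \<alpha> by (auto simp: space_PiM space_uniform_count_measure)
    ultimately show "\<exists>r\<in>relators \<Omega> k \<alpha>. g r \<noteq> \<one>\<^bsub>H\<^esub>"
      by (fastforce simp: flat_labelling_def relators_def)
  qed
next
  case False
  \<comment> \<open>A product with an empty factor is empty, and the claim is vacuous.\<close>
  then have "space (labelling_measure \<Omega> arev k j) = {}"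
    by (auto simp: labelling_measure_def space_PiM space_uniform_count_measure PiE_eq_empty_iff)
  then show ?thesis by (intro AE_I2) simp
qed


section \<open>Homomorphisms out of the random group\<close>

lemma relators_carrier:
  assumes "\<And>n. \<alpha> n \<in> labellings (\<Omega> n) (arev n) k j"
  shows "relators \<Omega> k \<alpha> \<subseteq> reduced_words {..<k}"
proof
  fix r assume "r \<in> relators \<Omega> k \<alpha>"
  then obtain n p u where r: "r = group_prod (free_group_rank k) (map (\<alpha> n) p)"
    and "pre_digraph.awalk (\<Omega> n) u p u"
    by (auto simp: relators_def)
  then have "set p \<subseteq> arcs (\<Omega> n)" by (simp add: pre_digraph.awalk_def)
  then have "set (map (\<alpha> n) p) \<subseteq> carrier (free_group_rank k)"
    using assms[of n] sym_gens_pow_carrier[of k j] by (fastforce simp: labellings_def)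
  then show "r \<in> reduced_words {..<k}"
    using group.group_prod_closed[OF group_free_group[of "{..<k}"]] r by simp
qed

text \<open>
  The composition of \<open>h\<close> with the quotient map is made extensional, so that it belongs to the
  countable set of \<open>countable_hom_free_group\<close>.
\<close>

lemma hom_random_group_pullback:
  assumes rel: "relators \<Omega> k \<alpha> \<subseteq> reduced_words {..<k}" and H: "group H"
    and h: "h \<in> hom (random_group \<Omega> k \<alpha>) H"
  obtains g where "g \<in> hom (free_group_rank k) H" "g \<in> extensional (reduced_words {..<k})"
    "g ` reduced_words {..<k} = h ` carrier (random_group \<Omega> k \<alpha>)"
    "\<And>r. r \<in> relators \<Omega> k \<alpha> \<Longrightarrow> g r = \<one>\<^bsub>H\<^esub>"
proof -
  let ?F = "free_group_rank k" and ?R = "relators \<Omega> k \<alpha>"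
  let ?K = "normal_closure ?F ?R"
  interpret F: group ?F by (rule group_free_group)
  interpret K: normal ?K ?F
    using rel by (intro F.normal_closure_normal) simp
  define g where "g = restrict (h \<circ> (\<lambda>a. ?K #>\<^bsub>?F\<^esub> a)) (reduced_words {..<k})"
  have "h \<circ> (\<lambda>a. ?K #>\<^bsub>?F\<^esub> a) \<in> hom ?F H"
    using K.r_coset_hom_Mod h hom_compose unfolding random_group_def by blast
  then have "g \<in> hom ?F H"
    unfolding g_def using F.m_closed by (auto simp: hom_def Pi_def)
  moreover have "g ` reduced_words {..<k} = h ` carrier (random_group \<Omega> k \<alpha>)"
    by (auto simp: g_def random_group_def carrier_FactGroup image_image)
  moreover have "g r = \<one>\<^bsub>H\<^esub>" if r: "r \<in> ?R" for r
  proof -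
    have "r \<in> ?K" using r by (auto simp: normal_closure_def)
    then have "?K #>\<^bsub>?F\<^esub> r = \<one>\<^bsub>random_group \<Omega> k \<alpha>\<^esub>"
      using F.coset_join2[OF _ K.subgroup_axioms] K.subset by (auto simp: random_group_def)
    moreover have "group (random_group \<Omega> k \<alpha>)"
      unfolding random_group_def by (rule K.factorgroup_is_group)
    ultimately show ?thesis
      using r rel hom_one[OF h _ H] by (auto simp: g_def)
  qed
  moreover have "g \<in> extensional (reduced_words {..<k})" by (simp add: g_def)
  ultimately show ?thesis using that by blast
qed

lemma AE_hom_random_group_finite_image:
  fixes H :: "('h, 'm) monoid_scheme"
  assumes G: "\<And>n. finite_connected_graph (\<Omega> n) (arev n)"
    and deg: "\<And>n v. v \<in> verts (\<Omega> n) \<Longrightarrow> out_degree (\<Omega> n) v \<ge> 2"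
    and "j \<ge> 1" and H: "group H" and "countable (carrier H)"
  shows "AE \<alpha> in labelling_measure \<Omega> arev k j.
           \<forall>h \<in> hom (random_group \<Omega> k \<alpha>) H. finite (h ` carrier (random_group \<Omega> k \<alpha>))"
proof -
  let ?C = "{g \<in> hom (free_group_rank k) H. g \<in> extensional (reduced_words {..<k})}"
  let ?I = "{g \<in> ?C. infinite (g ` reduced_words {..<k})}"
  have "countable ?C"
    using assms by (intro countable_hom_free_group) auto
  then have "countable ?I" by (rule countable_subset[rotated]) blast
  then have "AE \<alpha> in labelling_measure \<Omega> arev k j.
      \<forall>g\<in>?I. \<exists>r\<in>relators \<Omega> k \<alpha>. g r \<noteq> \<one>\<^bsub>H\<^esub>"
    using AE_relator_not_killed[OF G deg \<open>j \<ge> 1\<close> _ H] by (subst AE_ball_countable) auto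
  then show ?thesis
  proof (rule AE_mp, intro AE_I2 impI ballI)
    fix \<alpha> h
    assume \<alpha>: "\<alpha> \<in> space (labelling_measure \<Omega> arev k j)"
      and ex: "\<forall>g\<in>?I. \<exists>r\<in>relators \<Omega> k \<alpha>. g r \<noteq> \<one>\<^bsub>H\<^esub>"
      and h: "h \<in> hom (random_group \<Omega> k \<alpha>) H"
    have "\<alpha> n \<in> labellings (\<Omega> n) (arev n) k j" for n
      using \<alpha> by (auto simp: labelling_measure_def space_PiM space_uniform_count_measure)
    then have rel: "relators \<Omega> k \<alpha> \<subseteq> reduced_words {..<k}" by (rule relators_carrier)
    from hom_random_group_pullback[OF rel H h]
    obtain g where "g \<in> ?C" "g ` reduced_words {..<k} = h ` carrier (random_group \<Omega> k \<alpha>)"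
      "\<And>r. r \<in> relators \<Omega> k \<alpha> \<Longrightarrow> g r = \<one>\<^bsub>H\<^esub>"
      by (metis (no_types, lifting) mem_Collect_eq)
    then show "finite (h ` carrier (random_group \<Omega> k \<alpha>))"
      using ex by (metis (no_types, lifting) mem_Collect_eq)
  qed
qed

theorem theorem1p3:
  fixes \<Omega> :: "nat \<Rightarrow> ('a, 'b) pre_digraph" and arev :: "nat \<Rightarrow> 'b \<Rightarrow> 'b"
    and d k N j :: nat
  assumes "d \<ge> 3" and "k \<ge> 2"
    and "\<And>n. finite_connected_graph (\<Omega> n) (arev n)"
    and "\<And>n. regular_graph d (\<Omega> n)"
    and "expander \<Omega> arev"
    and "dg_bounded \<Omega> arev"
    and "large_girth \<Omega> arev"
    and "N \<ge> 1"
    and "j \<ge> 1"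
  shows "AE \<alpha> in labelling_measure \<Omega> arev k j.
           \<forall>h \<in> hom (random_group \<Omega> k \<alpha>) (Out (free_group_rank N)).
             finite (h ` carrier (random_group \<Omega> k \<alpha>))"
proof -
  have "out_degree (\<Omega> n) v \<ge> 2" if "v \<in> verts (\<Omega> n)" for n v
    using assms(1) assms(4)[of n] that by (simp add: regular_graph_def)
  then show ?thesis
    by (rule AE_hom_random_group_finite_image
          [OF assms(3) _ assms(9) group_Out[OF group_free_group] countable_Out_free_group])
qed

end
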